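(* Let $m,n,s$ be positive integers, let $\mathcal{X}=\{1,\ldots,m\}\times\{1,\ldots,n\}$, and let $\alpha,\beta$ be real numbers such that $\alpha i_1^s+\beta j_1^s\neq\alpha i_2^s+\beta j_2^s$ for all $(i_1,j_1),(i_2,j_2)\in\mathcal{X}$ with $(i_1,j_1)\neq(i_2,j_2)$. Then for every matrix $(a_{ij})\in\mathbb{R}^{m\times n}$ there exists a unique polynomial $p\in{}_{\alpha}^{\beta}\Pi_{s(mn-1)}^{2}$ such that $p(i,j)=a_{ij}$ for all $(i,j)\in\mathcal{X}$.
   Context: For real scalars $\alpha,\beta$ and a positive integer $s$, ${}_{\alpha}^{\beta}\Pi_{s(mn-1)}^{2}$ denotes the space of all bivariate real polynomials of the form $p(x,y)=\sum_{k=0}^{mn-1}\lambda_k(\alpha x^s+\beta y^s)^k$ with $\lambda_k\in\mathbb{R}$ for $0\le k\le mn-1$. *)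

theory Defs
  imports Complex_Main "HOL-Computational_Algebra.Polynomial"
begin

text \<open>Real polynomials in \<open>x\<close>, \<open>y\<close> are represented as polynomials in \<open>y\<close> whose coefficients are
  polynomials in \<open>x\<close>; a real scalar \<open>c\<close> is thus \<open>[:c:]\<close> as a coefficient.\<close>

type_synonym bpoly = "real poly poly"

definition var_x :: bpoly where
  "var_x = [:[:0, 1:]:]"

definition var_y :: bpoly where
  "var_y = [:0, 1:]"

definition scale :: "real \<Rightarrow> bpoly \<Rightarrow> bpoly" where
  "scale c p = smult [:c:] p"

definition eval2 :: "bpoly \<Rightarrow> real \<Rightarrow> real \<Rightarrow> real" where
  "eval2 p x y = poly (poly p [:y:]) x"

definition Pi_space :: "real \<Rightarrow> real \<Rightarrow> nat \<Rightarrow> nat \<Rightarrow> nat \<Rightarrow> bpoly set" where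
  "Pi_space \<alpha> \<beta> s m n =
     {p. \<exists>l :: nat \<Rightarrow> real.
        p = (\<Sum>k = 0..m * n - 1. scale (l k) ((scale \<alpha> (var_x ^ s) + scale \<beta> (var_y ^ s)) ^ k))}"

lemma eval2_var_x: "eval2 var_x x y = x"
  by (simp add: eval2_def var_x_def)

lemma eval2_var_y: "eval2 var_y x y = y"
  by (simp add: eval2_def var_y_def)

lemma eval2_add: "eval2 (p + q) x y = eval2 p x y + eval2 q x y"
  by (simp add: eval2_def)

lemma eval2_mult: "eval2 (p * q) x y = eval2 p x y * eval2 q x y"
  by (simp add: eval2_def)

lemma eval2_scale: "eval2 (scale c p) x y = c * eval2 p x y"
  by (simp add: eval2_def scale_def)

end

theory Submission
  imports Defs
begin

text \<open>On a member of the space, evaluation factors through the scalar \<open>t = \<alpha> x\<^sup>s + \<beta> y\<^sup>s\<close>, as a univariate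
  polynomial in \<open>t\<close> of degree at most \<open>m n - 1\<close>. The grid points have \<open>m n\<close> distinct values of \<open>t\<close>,
  so the claim is univariate Lagrange interpolation.\<close>

text \<open>Newton's incremental construction: when a node \<open>x\<close> joins \<open>A\<close>,
  add a multiple of the product \<open>w\<close> of the linear factors at the old nodes. It vanishes
  on \<open>A\<close>, so the old values survive, and not at \<open>x\<close>, so the factor can be
  chosen to correct the value there.\<close>

lemma lagrange_interpolation_exists:
  fixes f :: "'a::field \<Rightarrow> 'a"
  assumes "finite A"
  shows "\<exists>q. degree q \<le> card A - 1 \<and> (\<forall>x\<in>A. poly q x = f x)"
  using assms
proof (induction A rule: finite_induct)
  case empty
  show ?case by (intro exI[of _ 0]) simp
next
  case (insert x A)
  then obtain q where q: "degree q \<le> card A - 1" "\<forall>y\<in>A. poly q y = f y"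
    by blast
  define w where "w = (\<Prod>a\<in>A. [:- a, 1:])"
  define r where "r = q + smult ((f x - poly q x) / poly w x) w"
  have w_x: "poly w x \<noteq> 0"
    using insert.hyps by (auto simp: w_def poly_prod)
  have w_A: "poly w y = 0" if "y \<in> A" for y
    using insert.hyps that by (auto simp: w_def poly_prod)
  \<comment> \<open>The allowed degree after the insertion is
    \<open>card (insert x A) - 1 = card A\<close>.\<close>
  have "degree w \<le> card A"
    unfolding w_def using degree_prod_sum_le[OF insert.hyps(1), of "\<lambda>a. [:- a, 1:]"] by simp
  then have "degree r \<le> card A"
    unfolding r_def using q(1) by (intro degree_add_le) (auto intro: order_trans[OF degree_smult_le])
  moreover have "\<forall>y\<in>insert x A. poly r y = f y"
    using w_x w_A q(2) by (simp add: r_def)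
  ultimately show ?case
    using insert.hyps by (intro exI[of _ r]) simp
qed

lemma poly_sum_monom:
  fixes t :: "'a::comm_semiring_1"
  shows "poly (\<Sum>k\<in>K. monom (c k) k) t = (\<Sum>k\<in>K. c k * t ^ k)"
  by (simp add: poly_sum poly_monom)

text \<open>Evaluation at a fixed point is a ring homomorphism, so it passes through sums and powers
  down to the two variables.\<close>

lemma eval2_Pi_form:
  "eval2 (\<Sum>k\<in>K. scale (l k) ((scale \<alpha> (var_x ^ s) + scale \<beta> (var_y ^ s)) ^ k)) x y
     = (\<Sum>k\<in>K. l k * (\<alpha> * x ^ s + \<beta> * y ^ s) ^ k)"
proof -
  have eval2_sum: "eval2 (\<Sum>k\<in>K. g k) x y = (\<Sum>k\<in>K. eval2 (g k) x y)" for g :: "nat \<Rightarrow> bpoly"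
    by (simp add: eval2_def poly_sum)
  have eval2_power: "eval2 (p ^ k) x y = eval2 p x y ^ k" for p k
    by (simp add: eval2_def poly_power)
  show ?thesis
    by (simp add: eval2_sum eval2_power eval2_add eval2_scale eval2_var_x eval2_var_y)
qed

theorem theorem3p11:
  fixes m n s :: nat and \<alpha> \<beta> :: real and a :: "nat \<Rightarrow> nat \<Rightarrow> real"
  assumes "m \<ge> 1" and "n \<ge> 1" and "s \<ge> 1"
    and "\<And>i1 j1 i2 j2. (i1, j1) \<in> {1..m} \<times> {1..n} \<Longrightarrow> (i2, j2) \<in> {1..m} \<times> {1..n}
           \<Longrightarrow> (i1, j1) \<noteq> (i2, j2)
           \<Longrightarrow> \<alpha> * real i1 ^ s + \<beta> * real j1 ^ s \<noteq> \<alpha> * real i2 ^ s + \<beta> * real j2 ^ s"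
  shows "\<exists>!p. p \<in> Pi_space \<alpha> \<beta> s m n \<and>
           (\<forall>(i, j) \<in> {1..m} \<times> {1..n}. eval2 p (real i) (real j) = a i j)"
proof -
  define X where "X = {1..m} \<times> {1..n}"
  define t where "t = (\<lambda>(i, j). \<alpha> * real i ^ s + \<beta> * real j ^ s)"
  define N where "N = m * n - 1"
  define P where "P = (\<lambda>l. \<Sum>k = 0..N. scale (l k) ((scale \<alpha> (var_x ^ s) + scale \<beta> (var_y ^ s)) ^ k))"
  have inj: "inj_on t X"
    unfolding inj_on_def X_def t_def using assms(4) by fast
  have card: "card (t ` X) = m * n"
    using inj by (simp add: card_image X_def)
  have pos: "0 < m * n"
    using assms(1,2) by simp
  have fin: "finite (t ` X)"
    by (simp add: X_def)
  have mem: "p \<in> Pi_space \<alpha> \<beta> s m n \<longleftrightarrow> (\<exists>l. p = P l)" for p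
    by (simp add: Pi_space_def P_def N_def)
  have eval: "eval2 (P l) (real i) (real j) = (\<Sum>k = 0..N. l k * t (i, j) ^ k)" for l i j
    by (simp add: P_def eval2_Pi_form t_def)

  show ?thesis
    unfolding X_def[symmetric]
  proof (rule ex_ex1I)
    obtain q where q: "degree q \<le> N" "\<forall>x\<in>t ` X. poly q x = case_prod a (inv_into X t x)"
      using lagrange_interpolation_exists[OF fin, of "\<lambda>x. case_prod a (inv_into X t x)"]
      unfolding card N_def by blast
    have "eval2 (P (coeff q)) (real i) (real j) = a i j" if "(i, j) \<in> X" for i j
    proof -
      have "eval2 (P (coeff q)) (real i) (real j) = poly q (t (i, j))"
        \<comment> \<open>Since \<open>degree q \<le> N\<close>, the coefficients up to index
          \<open>N\<close> already determine \<open>q\<close>.\<close>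
        using poly_as_sum_of_monoms'[OF q(1)] by (metis (no_types) eval atLeast0AtMost poly_sum_monom)
      also have "\<dots> = a i j"
        using q(2) that inj by simp
      finally show ?thesis .
    qed
    then show "\<exists>p. p \<in> Pi_space \<alpha> \<beta> s m n \<and> (\<forall>(i, j)\<in>X. eval2 p (real i) (real j) = a i j)"
      unfolding mem by blast
  next
    fix p p'
    assume p: "p \<in> Pi_space \<alpha> \<beta> s m n \<and> (\<forall>(i, j)\<in>X. eval2 p (real i) (real j) = a i j)"
      and p': "p' \<in> Pi_space \<alpha> \<beta> s m n \<and> (\<forall>(i, j)\<in>X. eval2 p' (real i) (real j) = a i j)"
    obtain l l' where l: "p = P l" and l': "p' = P l'"
      using p p' mem by blast
    \<comment> \<open>\<open>Q c\<close> is the univariate polynomial whose value at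
      \<open>t (i, j)\<close> is that of \<open>P c\<close> at \<open>(i, j)\<close>.\<close>
    define Q where "Q = (\<lambda>c :: nat \<Rightarrow> real. \<Sum>k = 0..N. monom (c k) k)"
    have deg: "degree (Q c) < card (t ` X)" for c
    proof -
      have "degree (Q c) \<le> N"
        unfolding Q_def by (intro degree_sum_le) (auto intro: order_trans[OF degree_monom_le])
      then show ?thesis
        using pos unfolding card N_def by linarith
    qed
    have "poly (Q l) x = poly (Q l') x" if "x \<in> t ` X" for x
      using that p p' by (fastforce simp: Q_def poly_sum_monom l l' eval)
    then have "Q l = Q l'"
      using deg by (intro poly_eqI_degree[of "t ` X"]) auto
    then have "coeff (Q l) k = coeff (Q l') k" for k
      by simp
    \<comment> \<open>Beyond \<open>N\<close> the sequences may differ, but \<open>P\<close> reads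
      only the entries up to \<open>N\<close>.\<close>
    then have "l k = l' k" if "k \<le> N" for k
      using that by (simp add: Q_def coeff_sum sum.delta) metis
    then show "p = p'"
      by (simp add: l l' P_def)
  qed
qed

end
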